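(* For $n=0,1,\ldots$ let $G_n(x)=\frac1\pi\int_{-\infty}^\infty\frac{e^{-t^2/2}H_n(t)}{t-x}\,dt$. Then for every $m=0,1,\ldots$: $$G_{2m}(x)\sim a_0x,\qquad G_{2m+1}(x)\sim a_1,\qquad x\to0,$$ where $$a_0=-\sqrt2\,(2m)!\sum_{k=0}^m\frac{(-1)^k2^k}{(m-k)!\,\Gamma(k+1/2)},\qquad a_1=\sqrt2\,(2m+1)!\sum_{k=0}^m\frac{(-1)^k2^k}{(m-k)!\,\Gamma(k+3/2)},$$ and $$G_{2m}(x)\sim-\frac{2^{2m+1/2}\,\Gamma(m+1/2)}{\pi x},\qquad G_{2m+1}(x)\sim-\frac{2^{2m+5/2}\,\Gamma(m+3/2)}{\pi x^2},\qquad x\to\infty.$$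
   Context: The integral is a Cauchy principal value, and $G_n$ is defined for all real $x$. $H_n$ are the Hermite polynomials orthogonal on $(-\infty,\infty)$ with weight $e^{-x^2}$ and with leading coefficient $2^n$. $f\sim g$ means that the ratio $f/g$ tends to $1$ in the indicated limit. *)

theory Defs
  imports "HOL-Analysis.Analysis" "HOL-Library.Landau_Symbols"
    "HOL-Computational_Algebra.Polynomial"
begin

definition hermite_polys :: "(nat \<Rightarrow> real poly) \<Rightarrow> bool" where
  "hermite_polys H \<longleftrightarrow>
     (\<forall>n. degree (H n) = n \<and> lead_coeff (H n) = 2 ^ n) \<and>
     (\<forall>m n. m \<noteq> n \<longrightarrow>
        (LINT t|lborel. exp (- (t\<^sup>2)) * poly (H m) t * poly (H n) t) = 0)"

text \<open>Cauchy principal value over the real line of an integrand that is singular only at the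
  point \<open>x\<close> and Lebesgue integrable away from it (so no symmetric truncation at infinity is
  needed).\<close>

definition principal_value :: "real \<Rightarrow> (real \<Rightarrow> real) \<Rightarrow> real" where
  "principal_value x f =
     Lim (at_right 0) (\<lambda>\<epsilon>. LINT t:{t. \<epsilon> < \<bar>t - x\<bar>}|lborel. f t)"

definition G :: "(nat \<Rightarrow> real poly) \<Rightarrow> nat \<Rightarrow> real \<Rightarrow> real" where
  "G H n x = 1 / pi * principal_value x (\<lambda>t. exp (- (t\<^sup>2) / 2) * poly (H n) t / (t - x))"

definition a0 :: "nat \<Rightarrow> real" where
  "a0 m = - sqrt 2 * fact (2 * m) *
     (\<Sum>k=0..m. (- 1) ^ k * 2 ^ k / (fact (m - k) * Gamma (real k + 1 / 2)))"

definition a1 :: "nat \<Rightarrow> real" where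
  "a1 m = sqrt 2 * fact (2 * m + 1) *
     (\<Sum>k=0..m. (- 1) ^ k * 2 ^ k / (fact (m - k) * Gamma (real k + 3 / 2)))"

end

(* G_n is 1/pi times the principal value K(H_n)(x) of the integral of exp(-t^2/2) H_n(t) / (t - x).
   Writing t/(t - x) = 1 + x/(t - x) gives K(tp)(x) = x K(p)(x) + I(p), where I(p) is the integral
   of exp(-t^2/2) p(t).  So the three-term recurrence of the H_n carries over to the K(H_n), and only
   K(1) has to be analysed near 0, where folding the integral about x turns it into
   - exp(-x^2/2) times the integral of exp(-u^2/2) sinh(xu)/u.  At infinity K(p) tends to 0 for
   every p, so x K(p) tends to -I(p), and x^2 K(p) to -I(tp) when I(p) = 0.  The constants a0 and a1
   obey the same recurrences as the limits at 0, and those recurrences show that they are not 0. *)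

theory Submission
  imports Defs "HOL-Probability.Distributions" "HOL-Real_Asymp.Real_Asymp"
begin

text \<open>The family \<open>H\<close> is known only through degrees, leading coefficients and
  orthogonality, so no recurrence is at hand: an explicit family is built by the Rodrigues recursion
  and identified with \<open>H\<close> by uniqueness. Orthogonality refers to the weight exp(-t^2),
  whereas the transform carries exp(-t^2/2). Hence I(H_n) does not vanish for even n, and these
  moments are the inhomogeneous terms of the recurrence for K(H_n): they give the leading
  coefficients at infinity and feed into a1. For odd n the moment is 0, which is why the decay there
  is of second order.

  The principal value is defined by \<open>Lim\<close>, so each identity has to be proved together
  with convergence. That a0 and a1 are nonzero matters because f ~ 0 would force f to vanish near
  the point. Their sums alternate in sign, so this is not visible from size; it is read off from
  parity.\<close>

section \<open>Gaussian integrals of polynomials\<close>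

lemma integral_dominated_convergence_at_within:
  fixes s :: "real \<Rightarrow> 'a \<Rightarrow> real"
  assumes "f \<in> borel_measurable M" "\<And>t. s t \<in> borel_measurable M" "integrable M w"
    and lim: "AE x in M. ((\<lambda>t. s t x) \<longlongrightarrow> f x) (at c within A)"
    and bound: "\<And>t. t \<in> A \<Longrightarrow> t \<noteq> c \<Longrightarrow> AE x in M. \<bar>s t x\<bar> \<le> w x"
  shows "((\<lambda>t. integral\<^sup>L M (s t)) \<longlongrightarrow> integral\<^sup>L M f) (at c within A)"
  unfolding tendsto_at_iff_sequentially comp_def
proof (intro allI impI)
  fix X :: "nat \<Rightarrow> real"
  assume X: "\<forall>i. X i \<in> A - {c}" "X \<longlonglongrightarrow> c"
  have "AE x in M. (\<lambda>i. s (X i) x) \<longlonglongrightarrow> f x"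
    using lim by eventually_elim (use X in \<open>auto simp: tendsto_at_iff_sequentially comp_def\<close>)
  then show "(\<lambda>i. integral\<^sup>L M (s (X i))) \<longlonglongrightarrow> integral\<^sup>L M f"
    using assms X by (intro integral_dominated_convergence[where w=w]) auto
qed

lemma integrable_gauss_power:
  assumes "0 < a"
  shows "integrable lborel (\<lambda>t::real. exp (- (a * t\<^sup>2)) * t ^ k)"
proof -
  \<comment> \<open>With this standard deviation the normal density is a constant times exp(-a t^2),
    so normal moments apply.\<close>
  define s where "s = 1 / sqrt (2 * a)"
  have s: "0 < s" "2 * s\<^sup>2 = 1 / a" using assms by (auto simp: s_def power_divide)
  have "integrable lborel (\<lambda>t. sqrt (2 * pi * s\<^sup>2) * (normal_density 0 s t * (t - 0) ^ k))"
    using integrable_normal_moment[OF s(1), of 0 k] by (rule integrable_mult_right)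
  also have "(\<lambda>t. sqrt (2 * pi * s\<^sup>2) * (normal_density 0 s t * (t - 0) ^ k))
      = (\<lambda>t. exp (- (a * t\<^sup>2)) * t ^ k)"
  proof
    fix t show "sqrt (2 * pi * s\<^sup>2) * (normal_density 0 s t * (t - 0) ^ k) = exp (- (a * t\<^sup>2)) * t ^ k"
      using s(1) unfolding normal_density_def s(2) by (simp add: mult.commute)
  qed
  finally show ?thesis .
qed

lemma integrable_gauss_poly:
  fixes p :: "real poly"
  assumes "0 < a"
  shows "integrable lborel (\<lambda>t::real. exp (- (a * t\<^sup>2)) * poly p t)"
proof -
  have "integrable lborel (\<lambda>t::real. \<Sum>i\<le>degree p. coeff p i * (exp (- (a * t\<^sup>2)) * t ^ i))"
    using integrable_gauss_power[OF assms] by (intro Bochner_Integration.integrable_sum integrable_mult_right)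
  then show ?thesis
    by (simp add: poly_altdef sum_distrib_left mult_ac)
qed

lemma gauss_poly_has_derivative:
  "((\<lambda>t::real. exp (- (a * t\<^sup>2)) * poly p t) has_real_derivative
     exp (- (a * t\<^sup>2)) * poly (pderiv p - smult (2 * a) (pCons 0 p)) t) (at t)"
  by (auto intro!: derivative_eq_intros poly_DERIV simp: algebra_simps)

lemma tendsto_gauss_poly_at_top:
  fixes p :: "real poly"
  assumes "0 < a"
  shows "((\<lambda>t::real. exp (- (a * t\<^sup>2)) * poly p t) \<longlongrightarrow> 0) at_top"
proof -
  have "((\<lambda>t::real. \<Sum>i\<le>degree p. coeff p i * (exp (- (a * t\<^sup>2)) * t ^ i)) \<longlongrightarrow> 0) at_top"
  proof (intro tendsto_null_sum tendsto_mult_right_zero)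
    show "((\<lambda>t::real. exp (- (a * t\<^sup>2)) * t ^ i) \<longlongrightarrow> 0) at_top" for i
      using assms by real_asymp
  qed
  then show ?thesis
    by (simp add: poly_altdef sum_distrib_left mult_ac)
qed

lemma gauss_poly_integration_by_parts:
  fixes p :: "real poly"
  assumes "0 < a"
  shows "(LINT t|lborel. exp (- (a * t\<^sup>2)) * poly (pderiv p) t) =
         (LINT t|lborel. exp (- (a * t\<^sup>2)) * poly (smult (2 * a) (pCons 0 p)) t)"
proof -
  let ?F = "\<lambda>t::real. exp (- (a * t\<^sup>2)) * poly p t"
  let ?f = "\<lambda>t::real. exp (- (a * t\<^sup>2)) * poly (pderiv p - smult (2 * a) (pCons 0 p)) t"
  have int: "integrable lborel ?f"
    by (rule integrable_gauss_poly[OF assms])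
  have lim: "((\<lambda>R. LINT t|lborel. indicator {-R..R} t *\<^sub>R ?f t) \<longlongrightarrow> integral\<^sup>L lborel ?f) at_top"
  proof (rule integral_dominated_convergence_at_top[where w="\<lambda>t. \<bar>?f t\<bar>"])
    show "AE t in lborel. ((\<lambda>R. indicator {-R..R} t *\<^sub>R ?f t) \<longlongrightarrow> ?f t) at_top"
    proof (rule AE_I2)
      fix t :: real
      have "\<forall>\<^sub>F R in at_top. indicator {-R..R} t *\<^sub>R ?f t = ?f t"
        using eventually_ge_at_top[of "\<bar>t\<bar>"] by eventually_elim (auto simp: indicator_def)
      then show "((\<lambda>R. indicator {-R..R} t *\<^sub>R ?f t) \<longlongrightarrow> ?f t) at_top"
        by (rule tendsto_eventually)
    qed
  qed (use int in \<open>auto simp: indicator_def\<close>)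
  have "\<forall>\<^sub>F R in at_top. (LINT t|lborel. indicator {-R..R} t *\<^sub>R ?f t) = ?F R - ?F (-R)"
    using eventually_ge_at_top[of 0]
  proof eventually_elim
    fix R :: real assume R: "0 \<le> R"
    show "(LINT t|lborel. indicator {-R..R} t *\<^sub>R ?f t) = ?F R - ?F (-R)"
    proof (rule integral_FTC_atLeastAtMost)
      show "(?F has_vector_derivative ?f t) (at t within {-R..R})" for t
        using gauss_poly_has_derivative has_field_derivative_at_within
        unfolding has_real_derivative_iff_has_vector_derivative[symmetric] by blast
      show "continuous_on {-R..R} ?f"
        by (intro continuous_intros)
    qed (use R in simp)
  qed
  moreover have "((\<lambda>R. ?F R - ?F (-R)) \<longlongrightarrow> 0 - 0) at_top"
  proof (intro tendsto_diff tendsto_gauss_poly_at_top[OF assms])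
    \<comment> \<open>The boundary term at -R is the one at R for the reflected polynomial
      p(-t).\<close>
    show "((\<lambda>R. ?F (-R)) \<longlongrightarrow> 0) at_top"
      using tendsto_gauss_poly_at_top[OF assms, of "p \<circ>\<^sub>p [:0, -1:]"] by (simp add: poly_pcompose)
  qed
  ultimately have "((\<lambda>R. LINT t|lborel. indicator {-R..R} t *\<^sub>R ?f t) \<longlongrightarrow> 0) at_top"
    by (simp only: tendsto_cong diff_0_right)
  then have "integral\<^sup>L lborel ?f = 0"
    by (rule tendsto_unique[OF trivial_limit_at_top_linorder lim])
  then show ?thesis
    by (simp only: poly_diff right_diff_distrib eq_iff_diff_eq_0[symmetric]
        Bochner_Integration.integral_diff[OF integrable_gauss_poly integrable_gauss_poly, OF assms assms])
qed

section \<open>Hermite polynomials\<close>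

text \<open>Rodrigues' formula in recursive form: exp(-t^2) H_{n+1} is minus the derivative of
  exp(-t^2) H_n. This makes orthogonality a matter of integration by parts.\<close>

fun hermite :: "nat \<Rightarrow> real poly" where
  "hermite 0 = 1"
| "hermite (Suc n) = pCons 0 (smult 2 (hermite n)) - pderiv (hermite n)"

text \<open>Eliminates the derivative from the defining recursion, which then becomes the three-term
  recurrence. It also drives the recurrence for the moments I(H_n).\<close>

lemma pderiv_hermite: "pderiv (hermite (Suc n)) = smult (2 * real (Suc n)) (hermite n)"
proof (induction n)
  case 0
  show ?case by (simp add: pderiv_pCons pderiv_1)
next
  case (Suc n)
  have "pderiv (hermite (Suc (Suc n))) =
      smult 2 (hermite (Suc n)) + pCons 0 (smult 2 (pderiv (hermite (Suc n)))) - pderiv (pderiv (hermite (Suc n)))"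
    by (subst hermite.simps(2)) (simp add: pderiv_diff pderiv_pCons pderiv_smult del: hermite.simps)
  also have "\<dots> = smult 2 (hermite (Suc n)) + smult (2 * real (Suc n)) (pCons 0 (smult 2 (hermite n)) - pderiv (hermite n))"
    unfolding Suc.IH pderiv_smult by (simp add: smult_diff_right mult.commute)
  also have "\<dots> = smult (2 * real (Suc (Suc n))) (hermite (Suc n))"
    by (simp add: algebra_simps smult_add_left[symmetric] smult_diff_right)
  finally show ?case .
qed

lemma hermite_Suc_Suc:
  "hermite (Suc (Suc n)) = pCons 0 (smult 2 (hermite (Suc n))) - smult (2 * real (Suc n)) (hermite n)"
  by (subst hermite.simps(2)) (simp only: pderiv_hermite)

lemma degree_coeff_hermite: "degree (hermite n) = n \<and> coeff (hermite n) n = 2 ^ n"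
proof (induction n)
  case (Suc n)
  have nz: "hermite n \<noteq> 0" using Suc by auto
  have d: "degree (pCons 0 (smult 2 (hermite n))) = Suc n" using Suc nz by simp
  have "degree (pderiv (hermite n)) < Suc n"
    using Suc by (simp add: degree_pderiv)
  then have "degree (hermite (Suc n)) = Suc n" "coeff (pderiv (hermite n)) (Suc n) = 0"
    using d degree_add_eq_left[of "- pderiv (hermite n)" "pCons 0 (smult 2 (hermite n))"]
    by (auto intro: coeff_eq_0)
  then show ?case using Suc by simp
qed simp

text \<open>One integration by parts moves a Rodrigues step from H_{n+1} onto q: the integral
  against q equals that of H_n against q'. Both degrees drop together until q' is 0.\<close>

lemma hermite_orthogonal_lower_degree:
  assumes "degree q < n"
  shows "(LINT t|lborel. exp (- (t\<^sup>2)) * poly (hermite n * q) t) = 0"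
  using assms
proof (induction n arbitrary: q)
  case (Suc n)
  let ?I = "\<lambda>p. LINT t|lborel. exp (- (t\<^sup>2)) * poly p t"
  have int: "integrable lborel (\<lambda>t. exp (- (t\<^sup>2)) * poly p t)" for p :: "real poly"
    using integrable_gauss_poly[of 1 p] by simp
  have diff: "?I (p - r) = ?I p - ?I r" for p r :: "real poly"
    by (simp add: right_diff_distrib Bochner_Integration.integral_diff[OF int int])
  \<comment> \<open>The first bracket, times the weight, is minus the derivative of exp(-t^2) H_n q,
    so its integral is 0.\<close>
  have "?I (hermite (Suc n) * q) = ?I (smult 2 (pCons 0 (hermite n * q)) - pderiv (hermite n * q)) + ?I (hermite n * pderiv q)"
    by (subst Bochner_Integration.integral_add[symmetric, OF int int])
       (auto intro!: Bochner_Integration.integral_cong simp: pderiv_mult algebra_simps)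
  also have "?I (smult 2 (pCons 0 (hermite n * q)) - pderiv (hermite n * q)) = 0"
    using gauss_poly_integration_by_parts[of 1 "hermite n * q"] by (simp only: diff) simp
  also have "?I (hermite n * pderiv q) = 0"
  proof (cases "degree q = 0")
    case True
    then have "pderiv q = 0" using pderiv_eq_0_iff by blast
    then show ?thesis by simp
  next
    case False
    then show ?thesis using Suc by (intro Suc.IH) (simp add: degree_pderiv)
  qed
  finally show ?case by simp
qed simp

lemma poly_eq_0_if_gauss_norm_eq_0:
  assumes "(LINT t|lborel. exp (- (t\<^sup>2)) * poly (p * p) t) = (0 :: real)"
  shows "p = 0"
proof (rule ccontr)
  assume p: "p \<noteq> 0"
  have "AE t in lborel. exp (- (t\<^sup>2)) * poly (p * p) t = 0"
    using assms integrable_gauss_poly[of 1 "p * p"]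
    by (subst integral_nonneg_eq_0_iff_AE[symmetric]) auto
  moreover have "AE t in lborel. t \<notin> {t. poly p t = 0}"
    using finite_imp_null_set_lborel[OF poly_roots_finite[OF p]] by (rule AE_not_in)
  \<comment> \<open>A nonzero polynomial has only finitely many zeros, so the square cannot vanish
    almost everywhere.\<close>
  ultimately have "AE t::real in lborel. False"
    by eventually_elim simp
  then show False
    by (simp add: trivial_limit_def[symmetric] ae_filter_eq_bot_iff)
qed

text \<open>Pairwise orthogonality extends to all lower degrees because \<open>H d\<close> has exact
  degree d: subtracting a multiple of it removes the leading term of q.\<close>

lemma hermite_polys_orthogonal_lower_degree:
  assumes "hermite_polys H" "degree q < n"
  shows "(LINT t|lborel. exp (- (t\<^sup>2)) * poly (H n * q) t) = 0"
  using assms(2)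
proof (induction "degree q" arbitrary: q rule: less_induct)
  case less
  let ?I = "\<lambda>p. LINT t|lborel. exp (- (t\<^sup>2)) * poly p t"
  have int: "integrable lborel (\<lambda>t. exp (- (t\<^sup>2)) * poly p t)" for p :: "real poly"
    using integrable_gauss_poly[of 1 p] by simp
  define d where "d = degree q"
  have H: "degree (H d) = d" "coeff (H d) d = 2 ^ d"
    using assms(1) unfolding hermite_polys_def by metis+
  define c where "c = lead_coeff q / 2 ^ d"
  define r where "r = q - smult c (H d)"
  have q: "q = smult c (H d) + r" by (simp add: r_def)
  have "?I (H n * q) = ?I (smult c (H n * H d)) + ?I (H n * r)"
    by (subst Bochner_Integration.integral_add[symmetric, OF int int])
       (simp add: q distrib_left)
  also have "?I (smult c (H n * H d)) = c * ?I (H n * H d)"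
    by (simp add: mult.left_commute[of _ c])
  also have "?I (H n * H d) = 0"
  proof -
    have "n \<noteq> d" using less.prems by (auto simp: d_def)
    then show ?thesis using assms(1) by (simp add: hermite_polys_def mult.assoc)
  qed
  also have "?I (H n * r) = 0"
  proof (cases "r = 0")
    case False
    have "coeff r d = 0" "degree r \<le> d"
      using H by (auto simp: r_def c_def d_def intro!: degree_diff_le)
    then have "degree r < d"
      using False by (metis leading_coeff_0_iff order_le_imp_less_or_eq)
    then show ?thesis using less by (auto simp: d_def)
  qed simp
  finally show ?case by simp
qed

text \<open>Equal leading terms cancel, so the difference has degree below n. Both families are
  orthogonal to it, hence it is orthogonal to itself.\<close>

lemma hermite_polys_eq_hermite:
  assumes "hermite_polys H"
  shows "H n = hermite n"
proof (rule ccontr)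
  assume ne: "H n \<noteq> hermite n"
  define r where "r = H n - hermite n"
  have H: "degree (H n) = n" "coeff (H n) n = 2 ^ n"
    using assms unfolding hermite_polys_def by metis+
  have "coeff r n = 0" "degree r \<le> n"
    using H degree_coeff_hermite[of n] by (auto simp: r_def intro!: degree_diff_le)
  moreover have "r \<noteq> 0" using ne by (simp add: r_def)
  ultimately have "degree r < n"
    by (metis leading_coeff_0_iff order_le_imp_less_or_eq)
  have int: "integrable lborel (\<lambda>t. exp (- (t\<^sup>2)) * poly p t)" for p :: "real poly"
    using integrable_gauss_poly[of 1 p] by simp
  have "(LINT t|lborel. exp (- (t\<^sup>2)) * poly (r * r) t) =
     (LINT t|lborel. exp (- (t\<^sup>2)) * poly (H n * r) t) - (LINT t|lborel. exp (- (t\<^sup>2)) * poly (hermite n * r) t)"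
    by (subst Bochner_Integration.integral_diff[symmetric, OF int int])
       (auto intro!: Bochner_Integration.integral_cong simp: r_def algebra_simps)
  also have "\<dots> = 0"
    using \<open>degree r < n\<close> hermite_orthogonal_lower_degree hermite_polys_orthogonal_lower_degree[OF assms]
    by simp
  finally show False
    using poly_eq_0_if_gauss_norm_eq_0 \<open>r \<noteq> 0\<close> by blast
qed

section \<open>The principal value\<close>

lemma integrable_half_gauss_poly:
  "integrable lborel (\<lambda>t::real. exp (- (t\<^sup>2) / 2) * poly p t)"
  using integrable_gauss_poly[of "1/2" p] by simp

text \<open>A relation that includes convergence. \<open>Lim\<close> alone yields some value even
  when there is no limit, and could not be added or scaled safely.\<close>

definition has_pv :: "real \<Rightarrow> (real \<Rightarrow> real) \<Rightarrow> real \<Rightarrow> bool" where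
  "has_pv x f L \<longleftrightarrow>
     ((\<lambda>\<epsilon>. LINT t:{t. \<epsilon> < \<bar>t - x\<bar>}|lborel. f t) \<longlongrightarrow> L) (at_right 0)"

lemma has_pv_imp_principal_value: "has_pv x f L \<Longrightarrow> principal_value x f = L"
  unfolding has_pv_def principal_value_def by (rule tendsto_Lim) simp

lemma has_pv_add:
  assumes "has_pv x f A" "has_pv x g B"
    and "\<And>\<epsilon>. 0 < \<epsilon> \<Longrightarrow> set_integrable lborel {t. \<epsilon> < \<bar>t - x\<bar>} f"
    and "\<And>\<epsilon>. 0 < \<epsilon> \<Longrightarrow> set_integrable lborel {t. \<epsilon> < \<bar>t - x\<bar>} g"
  shows "has_pv x (\<lambda>t. f t + g t) (A + B)"
  unfolding has_pv_def
proof (rule Lim_transform_eventually)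
  show "((\<lambda>\<epsilon>. (LINT t:{t. \<epsilon> < \<bar>t - x\<bar>}|lborel. f t) + (LINT t:{t. \<epsilon> < \<bar>t - x\<bar>}|lborel. g t)) \<longlongrightarrow> A + B)
      (at_right 0)"
    using assms unfolding has_pv_def by (intro tendsto_add)
  show "\<forall>\<^sub>F \<epsilon> in at_right 0. (LINT t:{t. \<epsilon> < \<bar>t - x\<bar>}|lborel. f t) + (LINT t:{t. \<epsilon> < \<bar>t - x\<bar>}|lborel. g t)
      = (LINT t:{t. \<epsilon> < \<bar>t - x\<bar>}|lborel. f t + g t)"
    using eventually_at_right_less[of "0::real"]
    by eventually_elim (simp add: set_integral_add assms)
qed

lemma has_pv_cmult: "has_pv x f A \<Longrightarrow> has_pv x (\<lambda>t. c * f t) (c * A)"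
  unfolding has_pv_def by (simp add: tendsto_mult_left)

text \<open>The point x is never in the truncated domain, so the value 0 that division by zero
  produces there does no harm when t - x is cancelled.\<close>

lemma has_pv_cong:
  assumes "has_pv x f A" "\<And>t. t \<noteq> x \<Longrightarrow> f t = g t"
  shows "has_pv x g A"
  unfolding has_pv_def
proof (rule Lim_transform_eventually)
  show "((\<lambda>\<epsilon>. LINT t:{t. \<epsilon> < \<bar>t - x\<bar>}|lborel. f t) \<longlongrightarrow> A) (at_right 0)"
    using assms(1) unfolding has_pv_def .
  show "\<forall>\<^sub>F \<epsilon> in at_right 0. (LINT t:{t. \<epsilon> < \<bar>t - x\<bar>}|lborel. f t) = (LINT t:{t. \<epsilon> < \<bar>t - x\<bar>}|lborel. g t)"
    using eventually_at_right_less[of "0::real"]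
  proof eventually_elim
    case (elim \<epsilon>)
    then show ?case
      unfolding set_lebesgue_integral_def
      by (intro Bochner_Integration.integral_cong) (auto simp: indicator_def assms(2))
  qed
qed

lemma has_pv_integrable:
  assumes "integrable lborel f"
  shows "has_pv x f (integral\<^sup>L lborel f)"
  unfolding has_pv_def set_lebesgue_integral_def
proof (rule integral_dominated_convergence_at_within[where w="\<lambda>t. \<bar>f t\<bar>"])
  show "AE t in lborel. ((\<lambda>\<epsilon>. indicat_real {t. \<epsilon> < \<bar>t - x\<bar>} t *\<^sub>R f t) \<longlongrightarrow> f t) (at_right 0)"
    using AE_lborel_singleton[of x]
  proof eventually_elim
    case (elim t)
    have "\<forall>\<^sub>F \<epsilon> in at_right 0. \<epsilon> < \<bar>t - x\<bar>"
      using elim by (intro eventually_at_rightI[of 0 "\<bar>t - x\<bar>"]) auto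
    then have "\<forall>\<^sub>F \<epsilon> in at_right 0. indicat_real {t. \<epsilon> < \<bar>t - x\<bar>} t *\<^sub>R f t = f t"
      by eventually_elim (simp add: indicator_def)
    then show ?case by (rule tendsto_eventually)
  qed
  show "(\<lambda>t. indicat_real {t. \<epsilon> < \<bar>t - x\<bar>} t *\<^sub>R f t) \<in> borel_measurable lborel" for \<epsilon>
    using assms by measurable
qed (use assms in \<open>auto simp: indicator_def\<close>)

lemma set_integrable_cauchy_kernel:
  fixes F :: "real \<Rightarrow> real"
  assumes "integrable lborel F" "0 < \<epsilon>"
  shows "set_integrable lborel {t. \<epsilon> < \<bar>t - x\<bar>} (\<lambda>t. F t / (t - x))"
  unfolding set_integrable_def
proof (rule Bochner_Integration.integrable_bound)
  show "integrable lborel (\<lambda>t. F t / \<epsilon>)" using assms(1) by simp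
  show "(\<lambda>t. indicat_real {t. \<epsilon> < \<bar>t - x\<bar>} t *\<^sub>R (F t / (t - x))) \<in> borel_measurable lborel"
    using assms(1) by measurable
  show "AE t in lborel. norm (indicat_real {t. \<epsilon> < \<bar>t - x\<bar>} t *\<^sub>R (F t / (t - x))) \<le> norm (F t / \<epsilon>)"
    using assms(2) by (intro AE_I2) (auto simp: indicator_def abs_mult intro!: divide_left_mono)
qed

text \<open>Averaging the shifts \<open>t = x + u\<close> and \<open>t = x - u\<close> removes the singularity.\<close>

lemma cauchy_kernel_symmetrize:
  fixes F :: "real \<Rightarrow> real"
  assumes F: "integrable lborel F" and \<epsilon>: "0 < \<epsilon>"
  shows "(LINT t:{t. \<epsilon> < \<bar>t - x\<bar>}|lborel. F t / (t - x)) =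
         (LINT u:{u. \<epsilon> < \<bar>u\<bar>}|lborel. (F (x + u) - F (x - u)) / (2 * u))" (is "?I = _")
    and "set_integrable lborel {u. \<epsilon> < \<bar>u\<bar>} (\<lambda>u. (F (x + u) - F (x - u)) / (2 * u))"
proof -
  let ?f = "\<lambda>t. indicat_real {t. \<epsilon> < \<bar>t - x\<bar>} t *\<^sub>R (F t / (t - x))"
  have int: "integrable lborel ?f"
    using set_integrable_cauchy_kernel[OF assms] unfolding set_integrable_def .
  have I: "?I = integral\<^sup>L lborel ?f" unfolding set_lebesgue_integral_def ..
  have I1: "integral\<^sup>L lborel ?f = (LINT u|lborel. ?f (x + u))"
    using lborel_integral_real_affine[of 1 ?f x] by simp
  have I2: "integral\<^sup>L lborel ?f = (LINT u|lborel. ?f (x - u))"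
    using lborel_integral_real_affine[of "-1" ?f x] by simp
  have i1: "integrable lborel (\<lambda>u. ?f (x + u))" and i2: "integrable lborel (\<lambda>u. ?f (x - u))"
    using lborel_integrable_real_affine[OF int, of 1 x] lborel_integrable_real_affine[OF int, of "-1" x]
    by simp_all
  have eq: "(?f (x + u) + ?f (x - u)) / 2 =
      indicat_real {u. \<epsilon> < \<bar>u\<bar>} u *\<^sub>R ((F (x + u) - F (x - u)) / (2 * u))" for u
    using \<epsilon> by (auto simp: indicator_def field_simps)
  have "integrable lborel (\<lambda>u. (?f (x + u) + ?f (x - u)) / 2)"
    using i1 i2 by (intro integrable_divide_zero Bochner_Integration.integrable_add)
  then show "set_integrable lborel {u. \<epsilon> < \<bar>u\<bar>} (\<lambda>u. (F (x + u) - F (x - u)) / (2 * u))"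
    unfolding eq set_integrable_def .
  have "?I = (LINT u|lborel. (?f (x + u) + ?f (x - u)) / 2)"
    unfolding integral_divide_zero Bochner_Integration.integral_add[OF i1 i2] I I1[symmetric] I2[symmetric]
    by simp
  then show "?I = (LINT u:{u. \<epsilon> < \<bar>u\<bar>}|lborel. (F (x + u) - F (x - u)) / (2 * u))"
    unfolding eq set_lebesgue_integral_def .
qed

text \<open>Mean value theorem and monotonicity of cosh. It supplies the majorants for sinh(xu)/u
  and for sinh(xu)/(xu).\<close>

lemma abs_sinh_le: "\<bar>sinh y\<bar> \<le> \<bar>y\<bar> * cosh (y::real)"
proof -
  have pos: "sinh z \<le> z * cosh z" if "0 \<le> z" for z :: real
  proof (cases "z = 0")
    case False
    then have "\<exists>w. 0 < w \<and> w < z \<and> sinh z - sinh 0 = (z - 0) * cosh w"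
      using that by (intro MVT2) (auto intro!: derivative_eq_intros)
    then obtain w where w: "0 < w" "w < z" "sinh z = z * cosh w" by auto
    then show ?thesis using that by (simp add: cosh_real_nonneg_le_iff)
  qed simp
  show ?thesis
    using pos[of y] pos[of "-y"] by (cases "0 \<le> y") auto
qed

lemma integrable_gauss_cosh: "integrable lborel (\<lambda>u::real. exp (- (u\<^sup>2) / 2) * cosh (x * u))"
proof -
  have i: "integrable lborel (\<lambda>u::real. exp (- (u\<^sup>2) / 2 + y * u))" for y
  proof -
    have "integrable lborel (\<lambda>u::real. exp (- (u\<^sup>2) / 2) * poly 1 u)"
      by (rule integrable_half_gauss_poly)
    \<comment> \<open>Completing the square: exp(-u^2/2 + yu) is exp(y^2/2) times the Gaussian
      shifted by y.\<close>
    from lborel_integrable_real_affine[OF this, of 1 "-y"]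
    have "integrable lborel (\<lambda>u::real. exp (y\<^sup>2 / 2) * exp (- ((- y + u)\<^sup>2) / 2))"
      by simp
    also have "(\<lambda>u::real. exp (y\<^sup>2 / 2) * exp (- ((- y + u)\<^sup>2) / 2)) = (\<lambda>u. exp (- (u\<^sup>2) / 2 + y * u))"
      by (intro ext) (simp add: exp_add[symmetric] power2_eq_square field_simps)
    finally show ?thesis .
  qed
  have "integrable lborel (\<lambda>u::real. (exp (- (u\<^sup>2) / 2 + x * u) + exp (- (u\<^sup>2) / 2 + (- x) * u)) / 2)"
    by (intro integrable_divide_zero Bochner_Integration.integrable_add i)
  also have "(\<lambda>u::real. (exp (- (u\<^sup>2) / 2 + x * u) + exp (- (u\<^sup>2) / 2 + (- x) * u)) / 2)
      = (\<lambda>u. exp (- (u\<^sup>2) / 2) * cosh (x * u))"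
    by (intro ext) (simp only: exp_add, simp add: cosh_field_def field_simps)
  finally show ?thesis .
qed

section \<open>The transform K and the moment I: existence and linearity\<close>

definition hilbert_gauss :: "real poly \<Rightarrow> real \<Rightarrow> real" where
  "hilbert_gauss p x = principal_value x (\<lambda>t. exp (- (t\<^sup>2) / 2) * poly p t / (t - x))"

definition gauss_integral :: "real poly \<Rightarrow> real" where
  "gauss_integral p = (LINT t|lborel. exp (- (t\<^sup>2) / 2) * poly p t)"

lemma has_pv_hilbert_gauss_1:
  "has_pv x (\<lambda>t. exp (- (t\<^sup>2) / 2) * poly 1 t / (t - x))
     (- exp (- (x\<^sup>2) / 2) * (LINT u|lborel. exp (- (u\<^sup>2) / 2) * sinh (x * u) / u))"
proof -
  let ?F = "\<lambda>t::real. exp (- (t\<^sup>2) / 2) * poly 1 t"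
  let ?g = "\<lambda>u::real. exp (- (u\<^sup>2) / 2) * sinh (x * u) / u"
  have "integrable lborel ?g"
  proof (rule Bochner_Integration.integrable_bound)
    show "integrable lborel (\<lambda>u::real. \<bar>x\<bar> * (exp (- (u\<^sup>2) / 2) * cosh (x * u)))"
      by (intro integrable_mult_right integrable_gauss_cosh)
    show "?g \<in> borel_measurable lborel"
      unfolding sinh_field_def by measurable
    show "AE u in lborel. norm (?g u) \<le> norm (\<bar>x\<bar> * (exp (- (u\<^sup>2) / 2) * cosh (x * u)))"
    proof (rule AE_I2)
      fix u :: real
      show "norm (?g u) \<le> norm (\<bar>x\<bar> * (exp (- (u\<^sup>2) / 2) * cosh (x * u)))"
      proof (cases "u = 0")
        case False
        then show ?thesis
          using abs_sinh_le[of "x * u"]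
          by (simp add: abs_mult divide_le_eq) (simp add: mult_ac)
      qed simp
    qed
  qed
  \<comment> \<open>Folding has removed the singularity, so this principal value is a plain
    integral.\<close>
  then have "has_pv 0 ?g (integral\<^sup>L lborel ?g)"
    by (rule has_pv_integrable)
  then have lim: "has_pv 0 (\<lambda>u. - exp (- (x\<^sup>2) / 2) * ?g u) (- exp (- (x\<^sup>2) / 2) * integral\<^sup>L lborel ?g)"
    by (rule has_pv_cmult)
  have eq: "(?F (x + u) - ?F (x - u)) / (2 * u) = - exp (- (x\<^sup>2) / 2) * ?g u" for u
  proof -
    have "?F (x + u) = exp (- (x\<^sup>2) / 2) * exp (- (u\<^sup>2) / 2) * exp (- (x * u))"
      "?F (x - u) = exp (- (x\<^sup>2) / 2) * exp (- (u\<^sup>2) / 2) * exp (x * u)"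
      by (simp_all add: exp_add[symmetric] power2_eq_square field_simps)
    then show ?thesis
      by (simp only: sinh_field_def) (simp add: field_simps)
  qed
  show ?thesis
    unfolding has_pv_def
  proof (rule Lim_transform_eventually)
    show "((\<lambda>\<epsilon>. LINT u:{u. \<epsilon> < \<bar>u - 0\<bar>}|lborel. - exp (- (x\<^sup>2) / 2) * ?g u) \<longlongrightarrow>
        - exp (- (x\<^sup>2) / 2) * integral\<^sup>L lborel ?g) (at_right 0)"
      using lim unfolding has_pv_def .
    show "\<forall>\<^sub>F \<epsilon> in at_right 0. (LINT u:{u. \<epsilon> < \<bar>u - 0\<bar>}|lborel. - exp (- (x\<^sup>2) / 2) * ?g u) =
        (LINT t:{t. \<epsilon> < \<bar>t - x\<bar>}|lborel. ?F t / (t - x))"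
      using eventually_at_right_less[of "0::real"]
    proof eventually_elim
      case (elim \<epsilon>)
      show ?case
        unfolding cauchy_kernel_symmetrize(1)[OF integrable_half_gauss_poly elim] eq by simp
    qed
  qed
qed

text \<open>Induction step for existence: \<open>pCons a p\<close> is a + t p. The limits enter as
  hypotheses \<open>L\<close> and \<open>L1\<close> because convergence for p is not yet known at
  this stage.\<close>

lemma has_pv_hilbert_gauss_pCons:
  assumes "has_pv x (\<lambda>t. exp (- (t\<^sup>2) / 2) * poly p t / (t - x)) L"
    and "has_pv x (\<lambda>t. exp (- (t\<^sup>2) / 2) * poly 1 t / (t - x)) L1"
  shows "has_pv x (\<lambda>t. exp (- (t\<^sup>2) / 2) * poly (pCons a p) t / (t - x)) (a * L1 + (gauss_integral p + x * L))"
proof (rule has_pv_cong)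
  let ?e = "\<lambda>t::real. exp (- (t\<^sup>2) / 2)"
  have q: "set_integrable lborel {t. \<epsilon> < \<bar>t - x\<bar>} (\<lambda>t. ?e t * poly q t / (t - x))" if "0 < \<epsilon>" for q \<epsilon>
    by (rule set_integrable_cauchy_kernel[OF integrable_half_gauss_poly that])
  have i: "set_integrable lborel {t. \<epsilon> < \<bar>t - x\<bar>} (\<lambda>t. ?e t * poly p t)" for \<epsilon>
    unfolding set_integrable_def
    by (intro integrable_mult_indicator integrable_half_gauss_poly) measurable
  show "has_pv x (\<lambda>t. a * (?e t * poly 1 t / (t - x)) + (?e t * poly p t + x * (?e t * poly p t / (t - x))))
     (a * L1 + (gauss_integral p + x * L))"
    using has_pv_integrable[OF integrable_half_gauss_poly[of p], of x]
    by (intro has_pv_add has_pv_cmult assms set_integral_add set_integrable_mult_right q i)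
       (simp_all add: gauss_integral_def)
  show "a * (?e t * poly 1 t / (t - x)) + (?e t * poly p t + x * (?e t * poly p t / (t - x)))
      = ?e t * poly (pCons a p) t / (t - x)" if "t \<noteq> x" for t
    using that by (simp add: divide_simps) (simp add: algebra_simps)
qed

lemma has_pv_hilbert_gauss:
  "has_pv x (\<lambda>t. exp (- (t\<^sup>2) / 2) * poly p t / (t - x)) (hilbert_gauss p x)"
proof -
  have "\<exists>L. has_pv x (\<lambda>t. exp (- (t\<^sup>2) / 2) * poly p t / (t - x)) L"
  proof (induction p)
    case 0
    have "has_pv x (\<lambda>t. exp (- (t\<^sup>2) / 2) * poly 0 t / (t - x)) 0"
      by (simp add: has_pv_def set_lebesgue_integral_def)
    then show ?case ..
  next
    case (pCons a p)
    then show ?case using has_pv_hilbert_gauss_pCons has_pv_hilbert_gauss_1 by blast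
  qed
  then obtain L where L: "has_pv x (\<lambda>t. exp (- (t\<^sup>2) / 2) * poly p t / (t - x)) L" ..
  show ?thesis
    unfolding hilbert_gauss_def has_pv_imp_principal_value[OF L] by (rule L)
qed

lemma hilbert_gauss_eqI:
  "has_pv x (\<lambda>t. exp (- (t\<^sup>2) / 2) * poly p t / (t - x)) L \<Longrightarrow> hilbert_gauss p x = L"
  unfolding hilbert_gauss_def by (rule has_pv_imp_principal_value)

lemma hilbert_gauss_shift: "hilbert_gauss (pCons 0 p) x = x * hilbert_gauss p x + gauss_integral p"
  using hilbert_gauss_eqI[OF has_pv_hilbert_gauss_pCons[OF has_pv_hilbert_gauss has_pv_hilbert_gauss], of 0 p x]
  by simp

lemma hilbert_gauss_smult: "hilbert_gauss (smult c p) x = c * hilbert_gauss p x"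
  by (rule hilbert_gauss_eqI, rule has_pv_cong[OF has_pv_cmult[OF has_pv_hilbert_gauss]]) simp

lemma hilbert_gauss_add: "hilbert_gauss (p + q) x = hilbert_gauss p x + hilbert_gauss q x"
  by (rule hilbert_gauss_eqI, rule has_pv_cong[OF has_pv_add[OF has_pv_hilbert_gauss has_pv_hilbert_gauss]])
     (simp_all only: set_integrable_cauchy_kernel[OF integrable_half_gauss_poly] poly_add distrib_left add_divide_distrib)

lemma hilbert_gauss_diff: "hilbert_gauss (p - q) x = hilbert_gauss p x - hilbert_gauss q x"
  using hilbert_gauss_add[of p "smult (-1) q" x] hilbert_gauss_smult[of "-1" q x] by simp

section \<open>The transform of the pure Gaussian near the origin\<close>

lemma integral_exp_minus_half_square: "(LINT u::real|lborel. exp (- (u\<^sup>2) / 2)) = sqrt (2 * pi)"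
proof -
  have "(LINT u::real|lborel. exp (- (u\<^sup>2) / 2)) / sqrt (2 * pi) = (LINT u|lborel. normal_density 0 1 u)"
    by (simp add: normal_density_def)
  also have "\<dots> = 1" by simp
  finally show ?thesis by simp
qed

text \<open>Dividing the explicit formula for K(1) by x leaves sinh(xu)/(xu), which tends to 1. For
  \<bar>x\<bar> < 1 it is at most cosh u, and this is the majorant for dominated
  convergence.\<close>

lemma hilbert_gauss_1_derivative_at_0:
  "((\<lambda>x. hilbert_gauss 1 x / x) \<longlongrightarrow> - sqrt (2 * pi)) (at 0)"
proof -
  let ?h = "\<lambda>x u::real. exp (- (u\<^sup>2) / 2) * (sinh (x * u) / (x * u))"
  have "((\<lambda>x. LINT u|lborel. ?h x u) \<longlongrightarrow> (LINT u::real|lborel. exp (- (u\<^sup>2) / 2))) (at 0 within {-1<..<1})"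
  proof (rule integral_dominated_convergence_at_within)
    show "integrable lborel (\<lambda>u::real. exp (- (u\<^sup>2) / 2) * cosh (1 * u))"
      by (rule integrable_gauss_cosh)
    show "(\<lambda>u::real. exp (- (u\<^sup>2) / 2)) \<in> borel_measurable lborel"
      by measurable
    show "?h x \<in> borel_measurable lborel" for x
      unfolding sinh_field_def by measurable
    show "AE u in lborel. ((\<lambda>x. ?h x u) \<longlongrightarrow> exp (- (u\<^sup>2) / 2)) (at 0 within {-1<..<1})"
      \<comment> \<open>At u = 0 the quotient is 0 by convention instead of 1, so this single point
        is discarded.\<close>
      using AE_lborel_singleton[of 0]
    proof eventually_elim
      case (elim u)
      have "((\<lambda>x. ?h x u) \<longlongrightarrow> exp (- (u\<^sup>2) / 2)) (at 0)"
      proof -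
        have "((\<lambda>x. sinh (x * u) / (x * u)) \<longlongrightarrow> 1) (at 0)"
          using elim by (cases "u > 0") (real_asymp simp: sinh_field_def)+
        from tendsto_mult_left[OF this, of "exp (- (u\<^sup>2) / 2)"] show ?thesis by simp
      qed
      then show ?case by (rule tendsto_within_subset) simp
    qed
    show "AE u in lborel. \<bar>?h x u\<bar> \<le> exp (- (u\<^sup>2) / 2) * cosh (1 * u)"
      if x: "x \<in> {-1<..<1}" "x \<noteq> 0" for x
    proof (rule AE_I2)
      fix u :: real
      have "\<bar>sinh (x * u) / (x * u)\<bar> \<le> cosh (x * u)"
        using abs_sinh_le[of "x * u"] by (cases "x * u = 0") (auto simp: abs_mult divide_le_eq mult_ac)
      also have "\<dots> \<le> cosh u"
      proof -
        have "\<bar>x * u\<bar> \<le> 1 * \<bar>u\<bar>"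
          unfolding abs_mult using x by (intro mult_right_mono) auto
        then have "cosh \<bar>x * u\<bar> \<le> cosh \<bar>u\<bar>"
          by (subst cosh_real_nonneg_le_iff) auto
        then show ?thesis by (simp only: cosh_real_abs)
      qed
      finally show "\<bar>?h x u\<bar> \<le> exp (- (u\<^sup>2) / 2) * cosh (1 * u)"
        unfolding abs_mult abs_exp_cancel mult_1 by (rule mult_left_mono) simp
    qed
  qed
  moreover have "at 0 within {-1<..<1::real} = at 0"
    by (rule at_within_open) auto
  ultimately have h: "((\<lambda>x. LINT u|lborel. ?h x u) \<longlongrightarrow> sqrt (2 * pi)) (at 0)"
    by (simp only: integral_exp_minus_half_square)
  have "isCont (\<lambda>x::real. - exp (- (x\<^sup>2) / 2)) 0"
    by (intro continuous_intros) auto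
  then have "((\<lambda>x::real. - exp (- (x\<^sup>2) / 2)) \<longlongrightarrow> -1) (at 0)"
    using isContD by fastforce
  from tendsto_mult[OF this h]
  have "((\<lambda>x. - exp (- (x\<^sup>2) / 2) * (LINT u|lborel. ?h x u)) \<longlongrightarrow> -1 * sqrt (2 * pi)) (at 0)" .
  also have "(\<lambda>x. - exp (- (x\<^sup>2) / 2) * (LINT u|lborel. ?h x u)) = (\<lambda>x. hilbert_gauss 1 x / x)"
  proof
    fix x :: real
    have "?h x = (\<lambda>u. exp (- (u\<^sup>2) / 2) * sinh (x * u) / u / x)"
      by (intro ext) (simp add: mult.commute)
    then have "(LINT u|lborel. ?h x u) = (LINT u|lborel. exp (- (u\<^sup>2) / 2) * sinh (x * u) / u) / x"
      by (simp only: integral_divide_zero)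
    then show "- exp (- (x\<^sup>2) / 2) * (LINT u|lborel. ?h x u) = hilbert_gauss 1 x / x"
      unfolding hilbert_gauss_eqI[OF has_pv_hilbert_gauss_1] by simp
  qed
  finally show ?thesis by (simp only: mult_minus1)
qed

text \<open>\<open>M\<close> bounds the derivative of F on the unit window about x. There the folded
  quotient is at most \<open>M\<close> by the mean value inequality, and the window u \<in> [-1,1]
  has length 2. Outside it the kernel is integrated in absolute value.\<close>

lemma abs_hilbert_gauss_le:
  fixes p :: "real poly"
  defines "F \<equiv> \<lambda>t. exp (- (t\<^sup>2) / 2) * poly p t"
  assumes M: "0 \<le> M"
    "\<And>t. \<bar>t - x\<bar> \<le> 1 \<Longrightarrow> \<bar>exp (- (t\<^sup>2) / 2) * poly (pderiv p - pCons 0 p) t\<bar> \<le> M"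
  shows "\<bar>hilbert_gauss p x\<bar> \<le> 2 * M + (LINT t|lborel. indicat_real {t. 1 < \<bar>t - x\<bar>} t * \<bar>F t / (t - x)\<bar>)"
proof -
  define w where "w t = indicat_real {t. 1 < \<bar>t - x\<bar>} t * \<bar>F t / (t - x)\<bar>" for t
  let ?D = "\<lambda>u. (F (x + u) - F (x - u)) / (2 * u)"
  have F: "integrable lborel F"
    unfolding F_def by (rule integrable_half_gauss_poly)
  have w: "integrable lborel w"
  proof -
    have "integrable lborel (\<lambda>t. \<bar>indicat_real {t. 1 < \<bar>t - x\<bar>} t *\<^sub>R (F t / (t - x))\<bar>)"
      using set_integrable_cauchy_kernel[OF F, of 1 x] unfolding set_integrable_def
      by (intro integrable_abs) simp
    then show ?thesis by (simp add: w_def[abs_def] abs_mult)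
  qed
  have w1: "integrable lborel (\<lambda>u. w (x + u))" and w2: "integrable lborel (\<lambda>u. w (x - u))"
    using lborel_integrable_real_affine[OF w, of 1 x] lborel_integrable_real_affine[OF w, of "-1" x]
    by simp_all
  have I1: "(LINT u|lborel. w (x + u)) = integral\<^sup>L lborel w"
    and I2: "(LINT u|lborel. w (x - u)) = integral\<^sup>L lborel w"
    using lborel_integral_real_affine[of 1 w x] lborel_integral_real_affine[of "-1" w x] by simp_all
  \<comment> \<open>A majorant of the folded quotient that does not depend on \<epsilon>, so the
    bound survives the limit. The far part is averaged over x + u and x - u, which preserves its
    integral.\<close>
  let ?B = "\<lambda>u. M * indicat_real {-1..1} u + (w (x + u) + w (x - u)) / 2"
  have ind: "integrable lborel (\<lambda>u::real. M * indicat_real {-1..1} u)"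
    by (intro integrable_mult_right integrable_real_indicator) auto
  have w12: "integrable lborel (\<lambda>u. (w (x + u) + w (x - u)) / 2)"
    by (intro integrable_divide_zero Bochner_Integration.integrable_add w1 w2)
  have B: "integrable lborel ?B"
    by (rule Bochner_Integration.integrable_add[OF ind w12])
  have IB: "integral\<^sup>L lborel ?B = 2 * M + integral\<^sup>L lborel w"
  proof -
    have "integral\<^sup>L lborel ?B = (LINT u::real|lborel. M * indicat_real {-1..1} u) + (LINT u|lborel. (w (x + u) + w (x - u)) / 2)"
      by (rule Bochner_Integration.integral_add[OF ind w12])
    also have "(LINT u::real|lborel. M * indicat_real {-1..1} u) = 2 * M"
      by simp
    also have "(LINT u|lborel. (w (x + u) + w (x - u)) / 2) = integral\<^sup>L lborel w"
      unfolding integral_divide_zero Bochner_Integration.integral_add[OF w1 w2] I1 I2 by simp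
    finally show ?thesis .
  qed
  have D: "\<bar>?D u\<bar> \<le> ?B u" if "u \<noteq> 0" for u
  proof (cases "\<bar>u\<bar> \<le> 1")
    case True
    have "norm (F (x + u) - F (x - u)) \<le> M * norm ((x + u) - (x - u))"
    proof (rule field_differentiable_bound[where S="{x-1..x+1}"])
      fix t
      have "(F has_field_derivative exp (- (t\<^sup>2) / 2) * poly (pderiv p - pCons 0 p) t) (at t)"
        using gauss_poly_has_derivative[of "1/2" p t] unfolding F_def by simp
      then show "(F has_field_derivative exp (- (t\<^sup>2) / 2) * poly (pderiv p - pCons 0 p) t) (at t within {x-1..x+1})"
        by (rule has_field_derivative_at_within)
    next
      show "norm (exp (- (t\<^sup>2) / 2) * poly (pderiv p - pCons 0 p) t) \<le> M" if "t \<in> {x-1..x+1}" for t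
        using M(2)[of t] that by (simp add: abs_le_iff)
    qed (use True in auto)
    then have "\<bar>?D u\<bar> \<le> M"
      using that by (simp add: abs_mult divide_le_eq)
    moreover have "u \<in> {-1..1}" using True by auto
    moreover have "0 \<le> w t" for t by (simp add: w_def)
    ultimately show ?thesis by (simp add: add_increasing2)
  next
    case False
    then have "w (x + u) = \<bar>F (x + u)\<bar> / \<bar>u\<bar>" "w (x - u) = \<bar>F (x - u)\<bar> / \<bar>u\<bar>"
      by (auto simp: w_def indicator_def)
    moreover have "\<bar>F (x + u) - F (x - u)\<bar> / (2 * \<bar>u\<bar>) \<le> (\<bar>F (x + u)\<bar> + \<bar>F (x - u)\<bar>) / (2 * \<bar>u\<bar>)"
      by (intro divide_right_mono) auto
    moreover have "indicat_real {-1..1} u = 0" using False by (auto simp: indicator_def)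
    ultimately show ?thesis
      by (simp add: abs_mult add_divide_distrib)
  qed
  have bound: "\<bar>LINT t:{t. \<epsilon> < \<bar>t - x\<bar>}|lborel. F t / (t - x)\<bar> \<le> integral\<^sup>L lborel ?B" if "0 < \<epsilon>" for \<epsilon>
    unfolding cauchy_kernel_symmetrize(1)[OF F that] unfolding set_lebesgue_integral_def
  proof (rule integral_abs_bound_integral[OF _ B])
    show "integrable lborel (\<lambda>u. indicat_real {u. \<epsilon> < \<bar>u\<bar>} u *\<^sub>R ?D u)"
      using cauchy_kernel_symmetrize(2)[OF F that] unfolding set_integrable_def .
    have "0 \<le> ?B u" for u using M(1) by (simp add: w_def)
    then show "\<bar>indicat_real {u. \<epsilon> < \<bar>u\<bar>} u *\<^sub>R ?D u\<bar> \<le> ?B u" for u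
      using D[of u] that by (cases "\<epsilon> < \<bar>u\<bar>") auto
  qed
  have "((\<lambda>\<epsilon>. \<bar>LINT t:{t. \<epsilon> < \<bar>t - x\<bar>}|lborel. F t / (t - x)\<bar>) \<longlongrightarrow> \<bar>hilbert_gauss p x\<bar>) (at_right 0)"
    using has_pv_hilbert_gauss[of x p] unfolding has_pv_def F_def by (rule tendsto_rabs)
  then have "\<bar>hilbert_gauss p x\<bar> \<le> integral\<^sup>L lborel ?B"
    by (rule tendsto_upperbound) (use eventually_at_right_less[of "0::real"] bound in \<open>auto elim: eventually_mono\<close>)
  then show ?thesis unfolding IB unfolding w_def[abs_def] .
qed

text \<open>The far part tends to 0 by dominated convergence with majorant \<bar>F\<bar>, since
  \<bar>t - x\<bar> > 1 there. Near x the derivative of F is small because the whole window moves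
  off to infinity.\<close>

lemma hilbert_gauss_tendsto_0: "(hilbert_gauss p \<longlongrightarrow> 0) at_top"
proof (rule tendstoI)
  fix e :: real assume e: "0 < e"
  define F where "F t = exp (- (t\<^sup>2) / 2) * poly p t" for t
  define q where "q = pderiv p - pCons 0 p"
  let ?O = "\<lambda>x. LINT t|lborel. indicat_real {t. 1 < \<bar>t - x\<bar>} t * \<bar>F t / (t - x)\<bar>"
  have F: "integrable lborel F"
    unfolding F_def[abs_def] by (rule integrable_half_gauss_poly)
  then have Fm[measurable]: "F \<in> borel_measurable borel" by simp
  have "(?O \<longlongrightarrow> (LINT t::real|lborel. 0)) at_top"
  proof (rule integral_dominated_convergence_at_top[where w="\<lambda>t. \<bar>F t\<bar>"])
    show "AE t in lborel. ((\<lambda>x. indicat_real {t. 1 < \<bar>t - x\<bar>} t * \<bar>F t / (t - x)\<bar>) \<longlongrightarrow> 0) at_top"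
    proof (rule AE_I2)
      fix t :: real
      have "((\<lambda>x. 1 / (t - x)) \<longlongrightarrow> 0) at_top"
        by real_asymp
      from tendsto_rabs_zero[OF tendsto_mult_right_zero[OF this, of "F t"]]
      have "((\<lambda>x. \<bar>F t / (t - x)\<bar>) \<longlongrightarrow> 0) at_top" by simp
      then show "((\<lambda>x. indicat_real {t. 1 < \<bar>t - x\<bar>} t * \<bar>F t / (t - x)\<bar>) \<longlongrightarrow> 0) at_top"
        by (rule Lim_null_comparison[rotated]) (auto simp: indicator_def)
    qed
    show "\<forall>\<^sub>F x in at_top. AE t in lborel. norm (indicat_real {t. 1 < \<bar>t - x\<bar>} t * \<bar>F t / (t - x)\<bar>) \<le> \<bar>F t\<bar>"
      by (intro always_eventually allI AE_I2)
         (auto simp: indicator_def divide_le_eq mult_le_cancel_left1)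
  qed (use F in auto)
  then have "\<forall>\<^sub>F x in at_top. ?O x < e / 2"
    by (rule order_tendstoD(2)) (use e in simp)
  moreover have "\<forall>\<^sub>F x in at_top. \<forall>t. \<bar>t - x\<bar> \<le> 1 \<longrightarrow> \<bar>exp (- (t\<^sup>2) / 2) * poly q t\<bar> \<le> e / 8"
  proof -
    have "((\<lambda>t. exp (- (t\<^sup>2) / 2) * poly q t) \<longlongrightarrow> 0) at_top"
      using tendsto_gauss_poly_at_top[of "1/2" q] by simp
    from tendstoD[OF this, of "e / 8"] e
    obtain T where T: "\<And>t. T \<le> t \<Longrightarrow> \<bar>exp (- (t\<^sup>2) / 2) * poly q t\<bar> < e / 8"
      unfolding eventually_at_top_linorder by auto
    show ?thesis
      using eventually_ge_at_top[of "T + 1"]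
      by eventually_elim (use T in \<open>fastforce intro: less_imp_le\<close>)
  qed
  ultimately show "\<forall>\<^sub>F x in at_top. dist (hilbert_gauss p x) 0 < e"
  proof eventually_elim
    case (elim x)
    \<comment> \<open>The total is below e/4 + e/2, which leaves room for the strict
      inequality.\<close>
    have "\<bar>hilbert_gauss p x\<bar> \<le> 2 * (e / 8) + ?O x"
      unfolding F_def using elim(2) e unfolding q_def by (intro abs_hilbert_gauss_le) auto
    then show ?case using elim(1) e by simp
  qed
qed

section \<open>Recurrences for the Hermite polynomials\<close>

lemma gauss_integral_smult: "gauss_integral (smult c p) = c * gauss_integral p"
  unfolding gauss_integral_def by (simp add: mult.left_commute[of _ c])

lemma gauss_integral_diff: "gauss_integral (p - q) = gauss_integral p - gauss_integral q"
  unfolding gauss_integral_def poly_diff right_diff_distrib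
  by (rule Bochner_Integration.integral_diff[OF integrable_half_gauss_poly integrable_half_gauss_poly])

lemma gauss_integral_pderiv: "gauss_integral (pderiv p) = gauss_integral (pCons 0 p)"
  using gauss_poly_integration_by_parts[of "1/2" p] unfolding gauss_integral_def by simp

text \<open>By parts I(H_n') = I(t H_n), so applying I to H_{n+1} = 2 t H_n - H_n' leaves a single
  I(t H_n).\<close>

lemma gauss_integral_pCons_hermite: "gauss_integral (pCons 0 (hermite n)) = gauss_integral (hermite (Suc n))"
  using gauss_integral_smult[of 2 "pCons 0 (hermite n)"]
  by (simp add: gauss_integral_diff gauss_integral_pderiv)

lemma gauss_integral_hermite_0: "gauss_integral (hermite 0) = sqrt (2 * pi)"
  unfolding gauss_integral_def using integral_exp_minus_half_square by simp

lemma gauss_integral_hermite_1: "gauss_integral (hermite (Suc 0)) = 0"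
  unfolding gauss_integral_pCons_hermite[symmetric] gauss_integral_pderiv[symmetric]
  by (simp add: gauss_integral_def)

lemma gauss_integral_hermite_Suc_Suc:
  "gauss_integral (hermite (Suc (Suc n))) = 2 * real (Suc n) * gauss_integral (hermite n)"
  unfolding gauss_integral_pCons_hermite[symmetric, of "Suc n"] gauss_integral_pderiv[symmetric]
    pderiv_hermite gauss_integral_smult ..

lemma gauss_integral_hermite_odd: "gauss_integral (hermite (2 * m + 1)) = 0"
  by (induction m) (simp_all add: gauss_integral_hermite_1 gauss_integral_hermite_Suc_Suc del: hermite.simps)

text \<open>The factor 2(2m + 1) = 4(m + 1/2) of the moment recurrence is two powers of 2 and one
  step of Gamma.\<close>

lemma gauss_integral_hermite_even:
  "gauss_integral (hermite (2 * m)) = 2 powr (2 * real m + 1 / 2) * Gamma (real m + 1 / 2)"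
proof (induction m)
  case 0
  show ?case
    by (simp add: gauss_integral_hermite_0 powr_half_sqrt Gamma_one_half_real real_sqrt_mult del: hermite.simps)
next
  case (Suc m)
  have "2 powr (2 * real (Suc m) + 1 / 2) = 2 powr (2 + (2 * real m + 1 / 2))"
    by (simp add: algebra_simps)
  also have "\<dots> = 4 * (2::real) powr (2 * real m + 1 / 2)"
    by (subst powr_add) simp
  finally have 1: "2 powr (2 * real (Suc m) + 1 / 2) = 4 * (2::real) powr (2 * real m + 1 / 2)" .
  have "Gamma (real (Suc m) + 1 / 2) = Gamma ((real m + 1 / 2) + 1)"
    by (simp add: algebra_simps)
  also have "\<dots> = (real m + 1 / 2) * Gamma (real m + 1 / 2)"
    by (rule Gamma_plus1) (auto elim!: nonpos_Ints_cases)
  finally have 2: "Gamma (real (Suc m) + 1 / 2) = (real m + 1 / 2) * Gamma (real m + 1 / 2)" .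
  have "gauss_integral (hermite (2 * Suc m)) = 2 * real (Suc (2 * m)) * gauss_integral (hermite (2 * m))"
    using gauss_integral_hermite_Suc_Suc[of "2 * m"] by (simp del: hermite.simps)
  then show ?case unfolding 1 2 Suc.IH by (simp add: algebra_simps)
qed

lemma hilbert_gauss_hermite_Suc_Suc:
  "hilbert_gauss (hermite (Suc (Suc n))) x =
     2 * (x * hilbert_gauss (hermite (Suc n)) x + gauss_integral (hermite (Suc n)))
     - 2 * real (Suc n) * hilbert_gauss (hermite n) x"
  unfolding hermite_Suc_Suc hilbert_gauss_diff hilbert_gauss_smult hilbert_gauss_shift gauss_integral_smult
  by (simp add: algebra_simps)

lemma hilbert_gauss_hermite_Suc_0:
  "hilbert_gauss (hermite (Suc 0)) x = 2 * (x * hilbert_gauss 1 x + sqrt (2 * pi))"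
proof -
  have "hermite (Suc 0) = smult 2 (pCons 0 1)"
    by simp
  then show ?thesis
    using gauss_integral_hermite_0 by (simp only: hilbert_gauss_smult hilbert_gauss_shift hermite.simps(1))
qed

section \<open>The constants at the origin\<close>

lemma Gamma_nat_plus_half_nonzero: "Gamma (real k + 1 / 2) \<noteq> 0"
  by (rule less_imp_neq[THEN not_sym], rule Gamma_real_pos) simp

lemma Gamma_three_halves: "Gamma (3 / 2 :: real) = sqrt pi / 2"
proof -
  have "Gamma (1 / 2 + 1) = 1 / 2 * Gamma (1 / 2 :: real)"
    by (rule Gamma_plus1) (auto elim!: nonpos_Ints_cases)
  then show ?thesis by (simp add: Gamma_one_half_real)
qed

definition a0_sum :: "nat \<Rightarrow> real" where
  "a0_sum m = (\<Sum>k=0..m. (- 2) ^ k / (fact (m - k) * Gamma (real k + 1 / 2)))"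

definition a1_sum :: "nat \<Rightarrow> real" where
  "a1_sum m = (\<Sum>k=0..m. (- 2) ^ k / (fact (m - k) * Gamma (real k + 3 / 2)))"

lemma minus_1_power_times_2_power: "(- 1) ^ k * 2 ^ k = (- 2 :: real) ^ k"
  by (simp add: power_mult_distrib[symmetric])

lemma a0_eq: "a0 m = - sqrt 2 * fact (2 * m) * a0_sum m"
  unfolding a0_def a0_sum_def minus_1_power_times_2_power ..

lemma a1_eq: "a1 m = sqrt 2 * fact (2 * m + 1) * a1_sum m"
  unfolding a1_def a1_sum_def minus_1_power_times_2_power ..

text \<open>Shifting k by one turns Gamma(k + 1/2) into Gamma(k + 3/2); the term k = 0 stays behind
  as the explicit summand.\<close>

lemma a0_sum_Suc: "a0_sum (Suc m) = 1 / (fact (Suc m) * sqrt pi) - 2 * a1_sum m"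
proof -
  have "a0_sum (Suc m) = (- 2) ^ 0 / (fact (Suc m - 0) * Gamma (real 0 + 1 / 2)) +
      (\<Sum>k=0..m. (- 2) ^ Suc k / (fact (Suc m - Suc k) * Gamma (real (Suc k) + 1 / 2)))"
    unfolding a0_sum_def by (subst sum.atLeast0_atMost_Suc_shift) (simp only: o_def)
  also have "(\<Sum>k=0..m. (- 2) ^ Suc k / (fact (Suc m - Suc k) * Gamma (real (Suc k) + 1 / 2))) = - 2 * a1_sum m"
  proof -
    have "real (Suc k) + 1 / 2 = real k + 3 / 2" for k by simp
    then show ?thesis unfolding a1_sum_def sum_distrib_left 
      by (intro sum.cong refl) (simp only: diff_Suc_Suc power_Suc times_divide_eq_right)
  qed
  finally show ?thesis by (simp add: Gamma_one_half_real)
qed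

text \<open>The conditional stands for the convention that the a1 sum with index -1 is empty;
  truncated subtraction would give \<open>a1_sum 0\<close> instead.\<close>

lemma a0_sum_eq: "a0_sum m = 1 / (fact m * sqrt pi) - 2 * (if m = 0 then 0 else a1_sum (m - 1))"
  by (cases m) (simp_all add: a0_sum_Suc, simp add: a0_sum_def Gamma_one_half_real)

text \<open>In the k-th term write 2m + 1 = 2(k + 1/2) + 2(m - k). The first part lowers Gamma(k +
  3/2) to Gamma(k + 1/2) and gives the a0 sum; the second lowers (m - k)! and gives the previous a1
  sum.\<close>

lemma a1_sum_rec: "(2 * real m + 1) * a1_sum m + 2 * (if m = 0 then 0 else a1_sum (m - 1)) = 2 / (fact m * sqrt pi)"
proof -
  have "(2 * real m + 1) * a1_sum m =
      (\<Sum>k=0..m. 2 * ((- 2) ^ k / (fact (m - k) * Gamma (real k + 1 / 2))) +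
                 2 * real (m - k) * ((- 2) ^ k / (fact (m - k) * Gamma (real k + 3 / 2))))"
    unfolding a1_sum_def sum_distrib_left
  proof (rule sum.cong)
    fix k assume k: "k \<in> {0..m}"
    have g: "Gamma (real k + 3 / 2) = (real k + 1 / 2) * Gamma (real k + 1 / 2)"
    proof -
      have "real k + 3 / 2 = (real k + 1 / 2) + 1" by simp
      then show ?thesis by (simp only:) (rule Gamma_plus1, auto elim!: nonpos_Ints_cases)
    qed
    have split: "2 * real m + 1 = 2 * (real k + 1 / 2) + 2 * real (m - k)"
      using k by (simp add: of_nat_diff)
    have pos: "Gamma (real k + 1 / 2) \<noteq> 0" "real k + 1 / 2 \<noteq> 0"
      using Gamma_nat_plus_half_nonzero[of k] by auto
    show "(2 * real m + 1) * ((- 2) ^ k / (fact (m - k) * Gamma (real k + 3 / 2))) =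
        2 * ((- 2) ^ k / (fact (m - k) * Gamma (real k + 1 / 2))) +
                 2 * real (m - k) * ((- 2) ^ k / (fact (m - k) * Gamma (real k + 3 / 2)))"
    proof -
      have "(real k + 1 / 2) * ((- 2) ^ k / (fact (m - k) * Gamma (real k + 3 / 2)))
        = (- 2) ^ k / (fact (m - k) * Gamma (real k + 1 / 2))"
        unfolding g using pos(2)
        by (simp only: mult.left_commute times_divide_eq_right nonzero_mult_divide_mult_cancel_left) simp
      moreover have "(2 * (real k + 1 / 2) + 2 * real (m - k)) * y = 2 * ((real k + 1 / 2) * y) + 2 * real (m - k) * y"
        for y :: real
        by (simp only: distrib_right mult.assoc)
      ultimately show ?thesis unfolding split by (simp only:)
    qed
  qed simp
  also have "\<dots> = 2 * a0_sum m + (\<Sum>k=0..m. 2 * real (m - k) * ((- 2) ^ k / (fact (m - k) * Gamma (real k + 3 / 2))))"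
    unfolding sum.distrib a0_sum_def sum_distrib_left ..
  also have "(\<Sum>k=0..m. 2 * real (m - k) * ((- 2) ^ k / (fact (m - k) * Gamma (real k + 3 / 2)))) =
      2 * (if m = 0 then 0 else a1_sum (m - 1))"
  proof (cases m)
    case (Suc l)
    have "2 * real (m - k) * ((- 2) ^ k / (fact (m - k) * Gamma (real k + 3 / 2)))
        = 2 * ((- 2) ^ k / (fact (l - k) * Gamma (real k + 3 / 2)))" if "k \<le> l" for k
    proof -
      have "m - k = Suc (l - k)" using that Suc by simp
      then show ?thesis by (simp del: of_nat_Suc)
    qed
    then show ?thesis unfolding Suc by (simp add: a1_sum_def sum_distrib_left)
  qed simp
  finally show ?thesis unfolding a0_sum_eq by simp
qed

lemma a0_0: "a0 0 = - sqrt (2 / pi)"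
  by (simp add: a0_def Gamma_one_half_real real_sqrt_divide)

lemma a1_0: "a1 0 = 2 * sqrt (2 / pi)"
  by (simp add: a1_def Gamma_three_halves real_sqrt_divide)

text \<open>The form is dictated by the recurrence of K(H_{2m+2}) divided by x, whose moment term
  I(H_{2m+1}) is 0.\<close>

lemma a0_Suc: "a0 (Suc m) = 2 * a1 m - 2 * (2 * real m + 1) * a0 m"
proof -
  have "(2 * real m + 2) * a0_sum (Suc m) + 2 * a0_sum m + 2 * a1_sum m = 0"
  proof -
    have "(2 * real m + 2) * (1 / (fact (Suc m) * sqrt pi)) = 2 / (fact m * sqrt pi)"
    proof -
      have "fact (Suc m) = (real m + 1) * fact m" "real m + 1 \<noteq> 0" by (simp_all add: algebra_simps)
      then show ?thesis by (simp add: divide_simps)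
    qed
    then show ?thesis
      using a1_sum_rec[of m] unfolding a0_sum_Suc a0_sum_eq[of m] by (simp add: algebra_simps)
  qed
  then have *: "(2 * real m + 2) * a0_sum (Suc m) = - 2 * a0_sum m - 2 * a1_sum m" by simp
  have "a0 (Suc m) = - sqrt 2 * ((2 * real m + 1) * fact (2 * m)) * ((2 * real m + 2) * a0_sum (Suc m))"
    unfolding a0_eq by (simp add: algebra_simps)
  also have "\<dots> = 2 * a1 m - 2 * (2 * real m + 1) * a0 m"
    unfolding * a0_eq a1_eq by (simp add: algebra_simps)
  finally show ?thesis .
qed

text \<open>Counterpart for odd index; the inhomogeneous term is 2 I(H_{2m+2}) / pi.\<close>

lemma a1_Suc: "a1 (Suc m) = 2 * sqrt (2 / pi) * (fact (2 * Suc m) / fact (Suc m)) - 4 * real (Suc m) * a1 m"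
proof -
  have "a1 (Suc m) = sqrt 2 * fact (2 * Suc m) * ((2 * real (Suc m) + 1) * a1_sum (Suc m))"
    unfolding a1_eq by (simp add: algebra_simps)
  also have "(2 * real (Suc m) + 1) * a1_sum (Suc m) = 2 / (fact (Suc m) * sqrt pi) - 2 * a1_sum m"
    using a1_sum_rec[of "Suc m"] by simp
  also have "sqrt 2 * fact (2 * Suc m) * (2 / (fact (Suc m) * sqrt pi) - 2 * a1_sum m) =
     2 * sqrt (2 / pi) * (fact (2 * Suc m) / fact (Suc m)) - 2 * sqrt 2 * fact (2 * Suc m) * a1_sum m"
    by (simp add: right_diff_distrib real_sqrt_divide mult_ac del: fact_Suc)
  also have "2 * sqrt 2 * fact (2 * Suc m) * a1_sum m = 4 * real (Suc m) * a1 m"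
    unfolding a1_eq by (simp add: algebra_simps)
  finally show ?thesis .
qed

lemma fact_double_div_fact_Suc:
  "fact (2 * Suc m) / fact (Suc m) = 2 * (2 * real m + 1) * (fact (2 * m) / fact m)"
proof -
  have 1: "fact (2 * Suc m) = (real m + 1) * (2 * (2 * real m + 1) * fact (2 * m))"
    and 2: "fact (Suc m) = (real m + 1) * fact m" and 3: "real m + 1 \<noteq> 0"
    by (simp_all add: algebra_simps)
  show ?thesis
    unfolding 1 2 nonzero_mult_divide_mult_cancel_left[OF 3] times_divide_eq_right ..
qed

text \<open>The odd integer is the double factorial (2m - 1)!!.\<close>

lemma fact_double_div_fact: "\<exists>i::int. odd i \<and> fact (2 * m) / fact m = (2 ^ m * of_int i :: real)"
proof (induction m)
  case (Suc m)
  then obtain i :: int where i: "odd i" "fact (2 * m) / fact m = (2 ^ m * of_int i :: real)" by blast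
  note fact_double_div_fact_Suc
  also have "2 * (2 * real m + 1) * (fact (2 * m) / fact m) = 2 ^ Suc m * of_int ((2 * int m + 1) * i)"
    unfolding i(2) by simp
  finally show ?case using i(1) by (intro exI[of _ "(2 * int m + 1) * i"]) auto
qed (auto intro!: exI[of _ 1])

text \<open>Up to a factor \<open>sqrt (2 / pi)\<close> and powers of two, the recurrences keep both constants
  odd integers; in particular they do not vanish.\<close>

lemma a1_odd_multiple: "\<exists>i::int. odd i \<and> a1 m = 2 * sqrt (2 / pi) * 2 ^ m * of_int i"
proof (induction m)
  case 0
  show ?case by (auto simp: a1_0 intro!: exI[of _ 1])
next
  case (Suc m)
  then obtain i :: int where i: "odd i" "a1 m = 2 * sqrt (2 / pi) * 2 ^ m * of_int i" by blast
  obtain j :: int where j: "odd j" "fact (2 * Suc m) / fact (Suc m) = (2 ^ Suc m * of_int j :: real)"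
    using fact_double_div_fact by blast
  have "a1 (Suc m) = 2 * sqrt (2 / pi) * 2 ^ Suc m * of_int (j - 2 * int (Suc m) * i)"
    unfolding a1_Suc i(2) j(2) by (simp add: algebra_simps)
  then show ?case using j(1) by (intro exI[of _ "j - 2 * int (Suc m) * i"]) auto
qed

lemma a0_odd_multiple: "\<exists>i::int. odd i \<and> a0 m = sqrt (2 / pi) * 2 ^ m * of_int i"
proof (induction m)
  case 0
  show ?case by (auto simp: a0_0 intro!: exI[of _ "-1"])
next
  case (Suc m)
  then obtain i :: int where i: "odd i" "a0 m = sqrt (2 / pi) * 2 ^ m * of_int i" by blast
  obtain j :: int where j: "odd j" "a1 m = 2 * sqrt (2 / pi) * 2 ^ m * of_int j"
    using a1_odd_multiple by blast
  \<comment> \<open>Here the previous a0 decides the parity, as the a1 part enters with factor 2.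
    For a1 it is the inhomogeneous term that does so.\<close>
  have "a0 (Suc m) = sqrt (2 / pi) * 2 ^ Suc m * of_int (2 * j - (2 * int m + 1) * i)"
    unfolding a0_Suc i(2) j(2) by (simp add: algebra_simps)
  then show ?case using i(1) by (intro exI[of _ "2 * j - (2 * int m + 1) * i"]) auto
qed

lemma a0_nonzero: "a0 m \<noteq> 0"
  using a0_odd_multiple[of m] by auto

lemma a1_nonzero: "a1 m \<noteq> 0"
  using a1_odd_multiple[of m] by auto

section \<open>Asymptotics\<close>

lemma pi_times_sqrt_2_div_pi: "pi * sqrt (2 / pi) = sqrt (2 * pi)"
  by (simp add: real_sqrt_divide real_sqrt_mult real_div_sqrt field_simps)

text \<open>The same moments in the factorial form in which they occur in
  \<open>a1_Suc\<close>.\<close>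

lemma gauss_integral_hermite_even_fact:
  "gauss_integral (hermite (2 * m)) = sqrt (2 * pi) * (fact (2 * m) / fact m)"
proof (induction m)
  case 0
  show ?case using gauss_integral_hermite_0 by simp
next
  case (Suc m)
  have "gauss_integral (hermite (2 * Suc m)) = 2 * real (Suc (2 * m)) * gauss_integral (hermite (2 * m))"
    using gauss_integral_hermite_Suc_Suc[of "2 * m"] by (simp del: hermite.simps)
  then show ?case unfolding Suc.IH fact_double_div_fact_Suc by (simp add: mult_ac)
qed

text \<open>The two limits are proved jointly: the next even one needs both current ones, and the
  next odd one needs the new even one.\<close>

lemma hilbert_gauss_hermite_limits_at_0:
  "((\<lambda>x. hilbert_gauss (hermite (2 * m)) x / x) \<longlongrightarrow> pi * a0 m) (at 0) \<and>
   (hilbert_gauss (hermite (2 * m + 1)) \<longlongrightarrow> pi * a1 m) (at 0)"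
proof (induction m)
  case 0
  have 1: "((\<lambda>x. hilbert_gauss 1 x / x) \<longlongrightarrow> - sqrt (2 * pi)) (at 0)"
    by (rule hilbert_gauss_1_derivative_at_0)
  have "((\<lambda>x. 2 * (x * x * (hilbert_gauss 1 x / x) + sqrt (2 * pi))) \<longlongrightarrow>
      2 * (0 * 0 * - sqrt (2 * pi) + sqrt (2 * pi))) (at 0)"
    by (intro tendsto_intros 1)
  moreover have "2 * (x * x * (hilbert_gauss 1 x / x) + sqrt (2 * pi)) = hilbert_gauss (hermite (Suc 0)) x" for x
    unfolding hilbert_gauss_hermite_Suc_0 by simp
  ultimately have "(hilbert_gauss (hermite (Suc 0)) \<longlongrightarrow> 2 * sqrt (2 * pi)) (at 0)"
    by simp
  then show ?case
    using 1 pi_times_sqrt_2_div_pi by (simp add: a0_0 a1_0 mult.left_commute[of pi] del: hermite.simps(2))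
next
  case (Suc m)
  let ?h = "\<lambda>n. hilbert_gauss (hermite n)"
  have even: "((\<lambda>x. ?h (2 * m) x / x) \<longlongrightarrow> pi * a0 m) (at 0)"
    and odd: "(?h (2 * m + 1) \<longlongrightarrow> pi * a1 m) (at 0)"
    using Suc.IH by auto
  have "((\<lambda>x. 2 * ?h (2 * m + 1) x - 2 * real (Suc (2 * m)) * (?h (2 * m) x / x)) \<longlongrightarrow>
      2 * (pi * a1 m) - 2 * real (Suc (2 * m)) * (pi * a0 m)) (at 0)"
    by (intro tendsto_intros even odd)
  moreover have "\<forall>\<^sub>F x in at 0. 2 * ?h (2 * m + 1) x - 2 * real (Suc (2 * m)) * (?h (2 * m) x / x) = ?h (2 * Suc m) x / x"
  proof -
    have "2 * ?h (2 * m + 1) x - 2 * real (Suc (2 * m)) * (?h (2 * m) x / x) = ?h (2 * Suc m) x / x" if "x \<noteq> 0" for x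
    proof -
      have "?h (2 * Suc m) x = 2 * (x * ?h (2 * m + 1) x) - 2 * real (Suc (2 * m)) * ?h (2 * m) x"
        using hilbert_gauss_hermite_Suc_Suc[of "2 * m" x] gauss_integral_hermite_odd[of m]
        by (simp del: hermite.simps)
      then show ?thesis using that by (simp add: diff_divide_distrib del: hermite.simps)
    qed
    then show ?thesis by (auto simp: eventually_at_filter simp del: hermite.simps)
  qed
  ultimately have "((\<lambda>x. ?h (2 * Suc m) x / x) \<longlongrightarrow> 2 * (pi * a1 m) - 2 * real (Suc (2 * m)) * (pi * a0 m)) (at 0)"
    by (rule Lim_transform_eventually)
  also have "2 * (pi * a1 m) - 2 * real (Suc (2 * m)) * (pi * a0 m) = pi * a0 (Suc m)"
    unfolding a0_Suc by (simp add: algebra_simps)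
  finally have even': "((\<lambda>x. ?h (2 * Suc m) x / x) \<longlongrightarrow> pi * a0 (Suc m)) (at 0)" .
  let ?I = "gauss_integral (hermite (2 * Suc m))"
  \<comment> \<open>Writing x K as x^2 (K/x) makes the even limit applicable. The rewriting is valid
    even at x = 0, where both sides vanish.\<close>
  have "((\<lambda>x. 2 * (x * x * (?h (2 * Suc m) x / x) + ?I) - 2 * real (Suc (2 * m + 1)) * ?h (2 * m + 1) x)
     \<longlongrightarrow> 2 * (0 * 0 * (pi * a0 (Suc m)) + ?I) - 2 * real (Suc (2 * m + 1)) * (pi * a1 m)) (at 0)"
    by (intro tendsto_intros even' odd)
  moreover have "2 * (x * x * (?h (2 * Suc m) x / x) + ?I) - 2 * real (Suc (2 * m + 1)) * ?h (2 * m + 1) x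
      = ?h (2 * Suc m + 1) x" for x
    using hilbert_gauss_hermite_Suc_Suc[of "2 * m + 1" x] by (simp del: hermite.simps)
  moreover have "2 * (0 * 0 * (pi * a0 (Suc m)) + ?I) - 2 * real (Suc (2 * m + 1)) * (pi * a1 m) = pi * a1 (Suc m)"
    unfolding a1_Suc gauss_integral_hermite_even_fact pi_times_sqrt_2_div_pi[symmetric]
    by (simp add: algebra_simps del: fact_Suc)
  ultimately have "(?h (2 * Suc m + 1) \<longlongrightarrow> pi * a1 (Suc m)) (at 0)"
    by (simp only:)
  with even' show ?case by blast
qed

lemma hilbert_gauss_at_top: "((\<lambda>x. x * hilbert_gauss p x) \<longlongrightarrow> - gauss_integral p) at_top"
proof -
  have "((\<lambda>x. hilbert_gauss (pCons 0 p) x - gauss_integral p) \<longlongrightarrow> 0 - gauss_integral p) at_top"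
    by (intro tendsto_intros hilbert_gauss_tendsto_0)
  then show ?thesis by (simp add: hilbert_gauss_shift)
qed

lemma hilbert_gauss_at_top_sq:
  assumes "gauss_integral p = 0"
  shows "((\<lambda>x. x\<^sup>2 * hilbert_gauss p x) \<longlongrightarrow> - gauss_integral (pCons 0 p)) at_top"
  using hilbert_gauss_at_top[of "pCons 0 p"] assms
  by (simp add: hilbert_gauss_shift power2_eq_square mult.assoc)

theorem mainTheorem7:
  fixes H :: "nat \<Rightarrow> real poly" and m :: nat
  assumes "hermite_polys H"
  shows "(G H (2 * m) \<sim>[at 0] (\<lambda>x. a0 m * x)) \<and>
         (G H (2 * m + 1) \<sim>[at 0] (\<lambda>x. a1 m)) \<and>
         (G H (2 * m) \<sim>[at_top]
            (\<lambda>x. - (2 powr (2 * real m + 1 / 2) * Gamma (real m + 1 / 2)) / (pi * x))) \<and>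
         (G H (2 * m + 1) \<sim>[at_top]
            (\<lambda>x. - (2 powr (2 * real m + 5 / 2) * Gamma (real m + 3 / 2)) / (pi * x\<^sup>2)))"
proof -
  have G: "G H n x = hilbert_gauss (hermite n) x / pi" for n x
    unfolding G_def hilbert_gauss_def hermite_polys_eq_hermite[OF assms] by simp
  let ?h = "\<lambda>n. hilbert_gauss (hermite n)"
  note lim0 = hilbert_gauss_hermite_limits_at_0[of m]
  \<comment> \<open>Each equivalence is reduced to a ratio tending to 1; nonvanishing constants make
    the division legitimate.\<close>
  have "((\<lambda>x. ?h (2 * m) x / x / (pi * a0 m)) \<longlongrightarrow> pi * a0 m / (pi * a0 m)) (at 0)"
    using lim0 a0_nonzero by (intro tendsto_intros) auto
  then have 1: "G H (2 * m) \<sim>[at 0] (\<lambda>x. a0 m * x)"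
    using a0_nonzero by (intro asymp_equivI') (simp add: G mult_ac del: hermite.simps)
  have "((\<lambda>x. ?h (2 * m + 1) x / (pi * a1 m)) \<longlongrightarrow> pi * a1 m / (pi * a1 m)) (at 0)"
    using lim0 a1_nonzero by (intro tendsto_intros) auto
  then have 2: "G H (2 * m + 1) \<sim>[at 0] (\<lambda>x. a1 m)"
    using a1_nonzero by (intro asymp_equivI') (simp add: G del: hermite.simps)
  define C where "C k = 2 powr (2 * real k + 1 / 2) * Gamma (real k + 1 / 2)" for k
  have C: "C k = gauss_integral (hermite (2 * k))" "C k \<noteq> 0" for k
    using Gamma_nat_plus_half_nonzero[of k] by (simp_all add: C_def gauss_integral_hermite_even)
  have "((\<lambda>x. x * ?h (2 * m) x / - C m) \<longlongrightarrow> - C m / - C m) at_top"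
    using hilbert_gauss_at_top[of "hermite (2 * m)"] C by (intro tendsto_intros) auto
  then have 3: "G H (2 * m) \<sim>[at_top] (\<lambda>x. - C m / (pi * x))"
    using C(2) by (intro asymp_equivI') (simp add: G mult_ac del: hermite.simps)
  \<comment> \<open>The moment of H_{2m+1} is 0, so the leading constant is I(t H_{2m+1}) =
    I(H_{2m+2}). This index shift turns 2m + 1/2 into 2m + 5/2 and m + 1/2 into m + 3/2.\<close>
  have "((\<lambda>x. x\<^sup>2 * ?h (2 * m + 1) x) \<longlongrightarrow> - C (Suc m)) at_top"
    using hilbert_gauss_at_top_sq[OF gauss_integral_hermite_odd[of m]]
    unfolding gauss_integral_pCons_hermite C(1) by (simp del: hermite.simps)
  then have "((\<lambda>x. x\<^sup>2 * ?h (2 * m + 1) x / - C (Suc m)) \<longlongrightarrow> - C (Suc m) / - C (Suc m)) at_top"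
    using C(2) by (intro tendsto_intros) auto
  then have 4: "G H (2 * m + 1) \<sim>[at_top] (\<lambda>x. - C (Suc m) / (pi * x\<^sup>2))"
    using C(2) by (intro asymp_equivI') (simp add: G mult_ac del: hermite.simps)
  have "C (Suc m) = 2 powr (2 * real m + 5 / 2) * Gamma (real m + 3 / 2)"
    unfolding C_def by (simp add: algebra_simps)
  with 1 2 3 4 show ?thesis unfolding C_def by simp
qed

end
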